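(* Let $k \geq 3$ be an integer, and let $G$ be a finite connected graph of treedepth $k$. Then $\mathrm{col}_g(G) \leq 2k-3$ and $\mathrm{col}_{cg}(G) \leq 2k-3$.
   Context: All graphs are finite. Treedepth. For a rooted tree $T$, the height of $T$ is the number of vertices in a longest path in $T$ having the root as an endpoint. The closure of $T$ is the graph on $V(T)$ obtained by adding an edge from each vertex $v$ to all ancestors and all descendants of $v$ (with respect to the rooted structure of $T$). The treedepth of a graph $G$ is the minimum integer $k$ for which there exists a rooted tree $T$ of height $k$ such that $G$ is a subgraph of the closure of $T$. Marking game. In the marking game on $G$, two players, Alice and Bob, take turns marking unmarked vertices of $G$ one at a time, with Alice marking first, until all vertices are marked. Each vertex $v$ receives a score equal to the number of neighbors of $v$ marked before $v$, and the score of the play is the maximum score of a vertex. Alice wants to minimize the score of the play and Bob wants to maximize it. The game coloring number $\mathrm{col}_g(G)$ is the minimum integer $m$ for which Alice has a strategy guaranteeing that, at each game state, every unmarked vertex has at most $m-1$ marked neighbors; equivalently, $\mathrm{col}_g(G)-1$ is the minimum play score that Alice can guarantee. Connected marking game. This has the same rules, except that both Alice and Bob must play so that the set of marked vertices always induces a connected subgraph of $G$ (so every move after the first marks a vertex adjacent to an already marked vertex). The connected game coloring number $\mathrm{col}_{cg}(G)$ is defined in the same way as $\mathrm{col}_g(G)$, but with respect to the connected marking game. *)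

theory Defs
  imports "Graph_Theory.Graph_Theory"
begin

text \<open>
  Finite simple graphs are rendered by the locale \<^locale>\<open>pair_graph\<close>: finite, loop-free,
  symmetric digraphs without parallel arcs, an undirected edge being a pair of opposite arcs.
\<close>

section \<open>Treedepth\<close>

text \<open>
  The library's constant \<^const>\<open>tree\<close> is not usable here: in a symmetric digraph every edge
  already gives a directed cycle of length 2.  Cycles of an undirected graph have at least three
  vertices.
\<close>

definition undirected_tree :: "'a pair_pre_digraph \<Rightarrow> bool" where
  "undirected_tree T \<longleftrightarrow> pair_graph T \<and> connected (with_proj T) \<and>
     \<not> (\<exists>p. vpath p (with_proj T) \<and> length p \<ge> 3 \<and> (last p, hd p) \<in> parcs T)"

definition rooted_tree :: "'a pair_pre_digraph \<Rightarrow> 'a \<Rightarrow> bool" where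
  "rooted_tree T r \<longleftrightarrow> undirected_tree T \<and> r \<in> pverts T"

definition tree_height :: "'a pair_pre_digraph \<Rightarrow> 'a \<Rightarrow> nat" where
  "tree_height T r = Max {length p |p. vpath p (with_proj T) \<and> hd p = r}"

definition proper_ancestor :: "'a pair_pre_digraph \<Rightarrow> 'a \<Rightarrow> 'a \<Rightarrow> 'a \<Rightarrow> bool" where
  "proper_ancestor T r u v \<longleftrightarrow> u \<noteq> v \<and>
     (\<exists>p. vpath p (with_proj T) \<and> hd p = r \<and> last p = v \<and> u \<in> set p)"

definition tree_closure :: "'a pair_pre_digraph \<Rightarrow> 'a \<Rightarrow> 'a pair_pre_digraph" where
  "tree_closure T r =
     \<lparr> pverts = pverts T,
       parcs = parcs T \<union> {(u, v). proper_ancestor T r u v \<or> proper_ancestor T r v u} \<rparr>"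

definition subgraph_embedding ::
    "('a \<Rightarrow> 'b) \<Rightarrow> 'a pair_pre_digraph \<Rightarrow> 'b pair_pre_digraph \<Rightarrow> bool" where
  "subgraph_embedding f G H \<longleftrightarrow> inj_on f (pverts G) \<and> f ` pverts G \<subseteq> pverts H \<and>
     (\<forall>(u, v) \<in> parcs G. (f u, f v) \<in> parcs H)"

text \<open>
  The tree may have more vertices than \<open>G\<close>, possibly more than the type \<open>'a\<close> has elements;
  since every finite tree has a copy on natural numbers, ``subgraph'' is read up to isomorphism
  and the tree is taken on \<^typ>\<open>nat\<close>.  For finite \<open>G\<close> the set below is nonempty, so its
  infimum is its minimum.
\<close>

definition treedepth :: "'a pair_pre_digraph \<Rightarrow> nat" where
  "treedepth G = Inf {k. \<exists>(T :: nat pair_pre_digraph) r f.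
     rooted_tree T r \<and> tree_height T r = k \<and> subgraph_embedding f G (tree_closure T r)}"

section \<open>Marking games\<close>

text \<open>
  A game state is the list of the vertices marked so far, in the order of marking.  A rule
  says which vertices may be marked next in a given state.
\<close>

type_synonym 'a marking_rule = "'a list \<Rightarrow> 'a \<Rightarrow> bool"

definition marking_move :: "'a pair_pre_digraph \<Rightarrow> 'a marking_rule" where
  "marking_move G xs v \<longleftrightarrow> v \<in> pverts G \<and> v \<notin> set xs"

definition connected_marking_move :: "'a pair_pre_digraph \<Rightarrow> 'a marking_rule" where
  "connected_marking_move G xs v \<longleftrightarrow>
     marking_move G xs v \<and> connected (with_proj G \<restriction> insert v (set xs))"

text \<open>
  The states reachable when Alice plays by the strategy \<open>\<sigma>\<close> and Bob plays arbitrarily.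
  Alice marks first, so it is her turn when an even number of vertices is marked.
\<close>

inductive game_state :: "'a marking_rule \<Rightarrow> ('a list \<Rightarrow> 'a) \<Rightarrow> 'a list \<Rightarrow> bool"
  for rule :: "'a marking_rule" and \<sigma> :: "'a list \<Rightarrow> 'a" where
  start: "game_state rule \<sigma> []"
| alice: "game_state rule \<sigma> xs \<Longrightarrow> even (length xs) \<Longrightarrow> rule xs (\<sigma> xs) \<Longrightarrow>
    game_state rule \<sigma> (xs @ [\<sigma> xs])"
| bob: "game_state rule \<sigma> xs \<Longrightarrow> odd (length xs) \<Longrightarrow> rule xs v \<Longrightarrow>
    game_state rule \<sigma> (xs @ [v])"

definition legal_strategy ::
    "'a pair_pre_digraph \<Rightarrow> 'a marking_rule \<Rightarrow> ('a list \<Rightarrow> 'a) \<Rightarrow> bool" where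
  "legal_strategy G rule \<sigma> \<longleftrightarrow>
     (\<forall>xs. game_state rule \<sigma> xs \<and> even (length xs) \<and> set xs \<noteq> pverts G \<longrightarrow> rule xs (\<sigma> xs))"

definition marked_neighbors :: "'a pair_pre_digraph \<Rightarrow> 'a list \<Rightarrow> 'a \<Rightarrow> 'a set" where
  "marked_neighbors G xs v = {u \<in> set xs. (u, v) \<in> parcs G}"

text \<open>
  The bound ``at most \<open>m - 1\<close>'' is written with \<open>+ 1\<close> on the other side because subtraction
  on \<^typ>\<open>nat\<close> truncates.
\<close>

definition alice_guarantees :: "'a pair_pre_digraph \<Rightarrow> 'a marking_rule \<Rightarrow> nat \<Rightarrow> bool" where
  "alice_guarantees G rule m \<longleftrightarrow>
     (\<exists>\<sigma>. legal_strategy G rule \<sigma> \<and>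
       (\<forall>xs. game_state rule \<sigma> xs \<longrightarrow>
         (\<forall>v \<in> pverts G - set xs. card (marked_neighbors G xs v) + 1 \<le> m)))"

definition game_coloring_number :: "'a pair_pre_digraph \<Rightarrow> nat" where
  "game_coloring_number G = (LEAST m. alice_guarantees G (marking_move G) m)"

definition connected_game_coloring_number :: "'a pair_pre_digraph \<Rightarrow> nat" where
  "connected_game_coloring_number G =
     (LEAST m. alice_guarantees G (connected_marking_move G) m)"

end

theory Submission
  imports Defs "HOL-Library.Sublist"
begin

text \<open>
  Fix an elimination tree of height \<open>k\<close>.  Alice first marks the topmost vertex \<open>r\<close>.  Afterwards,
  if some ancestor of Bob's last vertex may legally be marked, she marks the highest such ancestor;
  otherwise she marks any legal vertex of minimal depth.  Every unmarked vertex adjacent to a marked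
  one is legal in both games.  Hence, while \<open>v\<close> is unmarked, each move of Bob on a descendant
  adjacent to \<open>v\<close> is answered by marking \<open>v\<close> or an ancestor of \<open>v\<close>.  Alice herself marks a
  descendant adjacent to \<open>v\<close> only when \<open>v\<close> has no marked neighbour; this happens at most once, and
  only if \<open>v\<close> is not adjacent to \<open>r\<close>.  So if \<open>v\<close> has \<open>a\<close> ancestors, its score is at most \<open>2 * a\<close>.
  This suffices for \<open>a \<le> k - 2\<close>, whereas a vertex with \<open>k - 1\<close> ancestors has no descendants.
\<close>

section \<open>Connected graphs\<close>

text \<open>Connectedness refers to the symmetric closure of the arcs; since \<open>G\<close> is
  symmetric, each step of that closure is an arc.\<close>

lemma connected_vertex_induct:
  assumes "pair_graph G" "connected (with_proj G)" "r \<in> pverts G" "v \<in> pverts G"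
    and "P r" and "\<And>u w. P u \<Longrightarrow> (u, w) \<in> parcs G \<Longrightarrow> P w"
  shows "P v"
proof -
  interpret pair_graph G by fact
  have "(r, v) \<in> rtrancl_on (pverts G) ((parcs G)\<^sup>s)"
    using assms(2-4) by (auto simp: connected_conv)
  then show ?thesis
  proof (induct rule: rtrancl_on_induct)
    case (step y z)
    then have "(y, z) \<in> parcs G"
      by (auto simp: symcl_def arcs_symmetric)
    with step show ?case using assms(6) by blast
  qed (rule \<open>P r\<close>)
qed

lemma connected_induce_singleton: "connected (with_proj G \<restriction> {v})"
  by (auto simp: connected_conv)

text \<open>Any two vertices are joined through \<open>w\<close>, because the reachability relation
  is symmetric and transitive.\<close>

lemma connected_induce_insert:
  assumes "connected (with_proj G \<restriction> S)" "w \<in> S" "(w, v) \<in> parcs G"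
  shows "connected (with_proj G \<restriction> insert v S)"
proof -
  define E where "E X = (arcs_ends (with_proj G \<restriction> X))\<^sup>s" for X
  have E_iff: "(a, b) \<in> E X \<longleftrightarrow> a \<in> X \<and> b \<in> X \<and> ((a, b) \<in> parcs G \<or> (b, a) \<in> parcs G)" for a b X
    by (auto simp: E_def symcl_def arcs_ends_conv)
  have sym: "sym (rtrancl_on (insert v S) (E (insert v S)))"
    by (rule rtrancl_on_sym) (auto simp: sym_def E_iff)
  have from_w: "(w, u) \<in> rtrancl_on (insert v S) (E (insert v S))" if "u \<in> insert v S" for u
  proof (cases "u \<in> S")
    case True
    with assms(1,2) have "(w, u) \<in> rtrancl_on S (E S)"
      by (auto simp: connected_conv E_def)
    then show ?thesis
      by (rule rtrancl_on_mono[rotated 2]) (auto simp: E_iff)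
  next
    case False
    with that have "u = v" by simp
    moreover have "(w, w) \<in> rtrancl_on (insert v S) (E (insert v S))"
      using assms(2) by auto
    moreover have "(w, v) \<in> E (insert v S)"
      using assms(2,3) by (simp add: E_iff)
    ultimately show ?thesis
      by (simp add: rtrancl_on_into_rtrancl_on)
  qed
  have "(u, u') \<in> rtrancl_on (insert v S) (E (insert v S))"
    if "u \<in> insert v S" "u' \<in> insert v S" for u u'
    using rtrancl_on_trans[OF symD[OF sym from_w[OF that(1)]] from_w[OF that(2)]] .
  then show ?thesis
    unfolding connected_conv E_def[symmetric] induce_subgraph_verts by blast
qed

section \<open>Root paths in trees\<close>

text \<open>If the paths part after \<open>x\<close>, following one to the common end and returning
  along the other yields a path from \<open>a\<close> to \<open>b\<close> that avoids
  \<open>x\<close>; adding \<open>x\<close> closes a cycle.\<close>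

lemma undirected_tree_vpath_unique:
  assumes T: "undirected_tree T"
    and "vpath (x # p) (with_proj T)" "vpath (x # q) (with_proj T)" "last (x # p) = last (x # q)"
  shows "p = q"
  using assms(2-)
proof (induction p arbitrary: x q)
  case Nil
  then show ?case by (cases q) (auto simp: vpath_def split: if_splits)
next
  case (Cons a p)
  interpret pair_graph T using T by (simp add: undirected_tree_def)
  from Cons.prems obtain b q' where q: "q = b # q'"
    by (cases q) (auto simp: vpath_def split: if_splits)
  have ap: "vwalk (a # p) (with_proj T)" "(x, a) \<in> parcs T" "x \<notin> set (a # p)"
    and bq: "vwalk (b # q') (with_proj T)" "(x, b) \<in> parcs T" "x \<notin> set (b # q')"
    using Cons.prems q by (auto simp: vpath_def)
  have "a = b"
  proof (rule ccontr)
    assume "a \<noteq> b"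
    have bq_rev: "vwalk (rev (b # q')) (with_proj T)"
      by (rule vwalk_rev_ex[OF _ bq(1)]) (rule sym_arcs)
    define c where "c = concat_vpath (a # p) (rev (b # q'))"
    have hd_rev: "hd (rev (b # q')) = last (a # p)"
      using Cons.prems q by (simp add: hd_rev del: rev.simps)
    have c: "vpath c (with_proj T)" "hd c = a" "last c = b"
      using concat_vpath_is_vpath[OF ap(1) refl refl bq_rev hd_rev refl]
      by (auto simp: c_def)
    have "set c \<subseteq> set ((a # p) @ tl (rev (b # q')))"
      unfolding c_def concat_vpath_def vwalk_join_def using vwalk_to_vpath_subset by fast
    also have "\<dots> \<subseteq> set (a # p) \<union> set (rev (b # q'))"
      using list.set_sel(2)[of "rev (b # q')"] by (auto simp del: rev.simps)
    finally have "set c \<subseteq> set (a # p) \<union> set (b # q')" by simp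
    then have "x \<notin> set c" using ap(3) bq(3) by auto
    then have "vpath (x # c) (with_proj T)"
      using c ap(2) by (auto simp: vpath_def intro!: vwalk_wf_digraph_consI)
    \<comment> \<open>This gives \<open>x # c\<close> the three vertices that a cycle must
      have.\<close>
    moreover have "length c \<ge> 2"
      using c \<open>a \<noteq> b\<close> by (cases c; cases "tl c") (auto simp: vpath_def)
    moreover have "(last (x # c), hd (x # c)) \<in> parcs T"
      using c \<open>length c \<ge> 2\<close> bq(2) arcs_symmetric by auto
    ultimately show False
      using T unfolding undirected_tree_def
      by (metis Suc_le_mono length_Cons numeral_2_eq_2 numeral_3_eq_3)
  qed
  then show ?case
    using Cons.IH[of a q'] Cons.prems q by (auto simp: vpath_def)
qed

text \<open>In a tree this path exists by connectedness and is unique. Root paths later serve as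
  labels, turning ancestry into the strict prefix order.\<close>

definition root_path :: "'a pair_pre_digraph \<Rightarrow> 'a \<Rightarrow> 'a \<Rightarrow> 'a list" where
  "root_path T r v = (THE p. vpath p (with_proj T) \<and> hd p = r \<and> last p = v)"

lemma root_path_eq:
  assumes "undirected_tree T" "vpath p (with_proj T)" "hd p = r" "last p = v"
  shows "root_path T r v = p"
  unfolding root_path_def
proof (rule the_equality)
  fix q assume q: "vpath q (with_proj T) \<and> hd q = r \<and> last q = v"
  have "p \<noteq> []" "q \<noteq> []" using assms(2) q by auto
  then obtain p' q' where "p = r # p'" "q = r # q'"
    using assms(3) q by (metis list.collapse)
  then show "q = p" using undirected_tree_vpath_unique[OF assms(1), of r q' p'] assms q by auto
qed (use assms in auto)

lemma root_path_vpath: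
  assumes "rooted_tree T r" "v \<in> pverts T"
  shows "vpath (root_path T r v) (with_proj T)" "hd (root_path T r v) = r"
    "last (root_path T r v) = v"
proof -
  have T: "undirected_tree T" and r: "r \<in> pverts T"
    using assms(1) by (auto simp: rooted_tree_def)
  then interpret pair_graph T by (simp add: undirected_tree_def)
  have "\<exists>p. vpath p (with_proj T) \<and> hd p = r \<and> last p = v"
  proof (rule connected_vertex_induct[OF _ _ r assms(2)])
    show "connected (with_proj T)" using T by (simp add: undirected_tree_def)
    show "\<exists>p. vpath p (with_proj T) \<and> hd p = r \<and> last p = r"
      using r by (intro exI[of _ "[r]"]) (simp add: vpath_self)
  next
    fix u w assume "\<exists>p. vpath p (with_proj T) \<and> hd p = r \<and> last p = u" "(u, w) \<in> parcs T"
    then show "\<exists>p. vpath p (with_proj T) \<and> hd p = r \<and> last p = w"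
      by (metis reachable_vpath_conv reachable_adj_trans)
  qed (rule pair_graph)
  then obtain p where p: "vpath p (with_proj T)" "hd p = r" "last p = v"
    by blast
  then show "vpath (root_path T r v) (with_proj T)" "hd (root_path T r v) = r"
    "last (root_path T r v) = v"
    by (simp_all add: root_path_eq[OF T p])
qed

text \<open>Cutting the root path of \<open>v\<close> after \<open>u\<close> leaves a path from
  \<open>r\<close> to \<open>u\<close>, which by uniqueness is the root path of
  \<open>u\<close>.\<close>

lemma proper_ancestor_root_path:
  assumes "rooted_tree T r" "proper_ancestor T r u v"
  shows "strict_prefix (root_path T r u) (root_path T r v)"
proof -
  have T: "undirected_tree T" using assms(1) by (auto simp: rooted_tree_def)
  obtain p where "u \<noteq> v" and p: "vpath p (with_proj T)" "hd p = r" "last p = v" "u \<in> set p"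
    using assms(2) by (auto simp: proper_ancestor_def)
  then obtain p1 p2 where split: "p = (p1 @ [u]) @ p2"
    by (metis split_list append_Cons append_Nil append_assoc)
  have "p2 \<noteq> []" using split p(3) \<open>u \<noteq> v\<close> by auto
  have "vpath (p1 @ [u]) (with_proj T)"
    using p(1) split vwalkI_append_l[of "p1 @ [u]" p2] by (auto simp: vpath_def)
  moreover have "hd (p1 @ [u]) = r" using p(2) split by (cases p1) auto
  ultimately have "root_path T r u = p1 @ [u]" by (intro root_path_eq[OF T]) auto
  moreover have "root_path T r v = p" using root_path_eq[OF T] p by blast
  ultimately show ?thesis using split \<open>p2 \<noteq> []\<close> by (auto simp: strict_prefix_def)
qed

text \<open>Either \<open>y\<close> lies on the root path of \<open>x\<close> and is an ancestor, or
  appending \<open>y\<close> to that path gives the root path of \<open>y\<close>.\<close>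

lemma tree_arc_root_path:
  assumes "rooted_tree T r" "(x, y) \<in> parcs T"
  shows "strict_prefix (root_path T r x) (root_path T r y) \<or>
    strict_prefix (root_path T r y) (root_path T r x)"
proof -
  have T: "undirected_tree T" using assms(1) by (auto simp: rooted_tree_def)
  then interpret pair_graph T by (simp add: undirected_tree_def)
  have xy: "x \<noteq> y" "x \<in> pverts T" "y \<in> pverts T"
    using assms(2) no_loops' wellformed' by auto
  note px = root_path_vpath[OF assms(1) xy(2)]
  show ?thesis
  proof (cases "y \<in> set (root_path T r x)")
    case True
    then have "proper_ancestor T r y x"
      using px xy by (auto simp: proper_ancestor_def)
    then show ?thesis using proper_ancestor_root_path[OF assms(1)] by blast
  next
    case False
    have ne: "root_path T r x \<noteq> []" using px(1) by auto
    have "vwalk (root_path T r x @ [y]) (with_proj T)"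
      using px ne xy assms(2) by (auto simp: vpath_def vwalk_def set_vwalk_arcs_snoc)
    then have "vpath (root_path T r x @ [y]) (with_proj T)"
      using px(1) False by (auto simp: vpath_def)
    then have "root_path T r y = root_path T r x @ [y]"
      using px ne by (intro root_path_eq[OF T]) auto
    then show ?thesis by (auto simp: strict_prefix_def)
  qed
qed

lemma tree_closure_arc_root_path:
  assumes "rooted_tree T r" "(x, y) \<in> parcs (tree_closure T r)"
  shows "strict_prefix (root_path T r x) (root_path T r y) \<or>
    strict_prefix (root_path T r y) (root_path T r x)"
  using assms(2) tree_arc_root_path[OF assms(1)] proper_ancestor_root_path[OF assms(1)]
  by (auto simp: tree_closure_def)

lemma length_root_path_le:
  assumes "rooted_tree T r" "v \<in> pverts T"
  shows "length (root_path T r v) \<le> tree_height T r"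
proof -
  interpret pair_graph T using assms(1) by (simp add: undirected_tree_def rooted_tree_def)
  have "finite {length p |p. vpath p (with_proj T) \<and> hd p = r}"
    using vpaths_finite by (rule finite_surj[where f = length]) auto
  then show ?thesis
    unfolding tree_height_def using root_path_vpath[OF assms] by (intro Max_ge) auto
qed

section \<open>The treedepth is attained\<close>

text \<open>Rooted at \<open>0\<close>, its closure is a complete graph, into which every graph on
  \<open>n\<close> vertices embeds. Hence the infimum defining \<open>treedepth\<close> is over a
  nonempty set.\<close>

definition path_graph :: "nat \<Rightarrow> nat pair_pre_digraph" where
  "path_graph n = \<lparr> pverts = {..<n},
     parcs = {(i, j). i < n \<and> j < n \<and> (j = Suc i \<or> i = Suc j)} \<rparr>"

lemma pair_graph_path_graph: "pair_graph (path_graph n)"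
proof
  show "finite (parcs (path_graph n))"
    by (rule finite_subset[of _ "{..<n} \<times> {..<n}"]) (auto simp: path_graph_def)
qed (auto simp: path_graph_def symmetric_def sym_def)

lemma vpath_path_graph_upt:
  assumes "j < n"
  shows "vpath [0..<Suc j] (with_proj (path_graph n))"
  using assms
proof (induction j)
  case 0
  then show ?case by (auto simp: vpath_def path_graph_def)
next
  case (Suc j)
  then have "vwalk ([0..<Suc j] @ [Suc j]) (with_proj (path_graph n))"
    unfolding vpath_def vwalk_def
    by (subst set_vwalk_arcs_snoc) (auto simp: path_graph_def)
  then show ?case by (simp add: vpath_def)
qed

text \<open>The position of the second vertex fixes the direction, which the induction needs.\<close>

lemma vpath_path_graph_monotone:
  assumes "vpath p (with_proj (path_graph n))"
  shows "last p + 1 = hd p + length p \<and> (length p \<ge> 2 \<longrightarrow> p ! 1 = Suc (hd p)) \<or>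
    hd p + 1 = last p + length p \<and> (length p \<ge> 2 \<longrightarrow> hd p = Suc (p ! 1))"
  using assms
proof (induction p rule: vwalk_arcs.induct)
  case (3 x y xs)
  then have IH: "vpath (y # xs) (with_proj (path_graph n))" and "x \<noteq> y" "x \<notin> set xs"
    and "x = Suc y \<or> y = Suc x"
    by (auto simp: vpath_def vwalk_def path_graph_def)
  \<comment> \<open>A change of direction at \<open>y\<close> would lead back to \<open>x\<close>,
    which the path has already visited.\<close>
  with "3.IH"[OF IH] show ?case
    by (cases xs) auto
qed auto

lemma rooted_tree_path_graph:
  assumes "n > 0"
  shows "rooted_tree (path_graph n) 0"
proof -
  interpret pair_graph "path_graph n" by (rule pair_graph_path_graph)
  have reach: "0 \<rightarrow>\<^sup>*\<^bsub>with_proj (path_graph n)\<^esub> j" if "j < n" for j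
    using vpath_path_graph_upt[OF that] unfolding reachable_vpath_conv
    by (intro exI[of _ "[0..<Suc j]"]) (auto simp: hd_upt simp del: upt_Suc)
  have "connected (with_proj (path_graph n))"
  proof (rule connectedI)
    show "pverts (path_graph n) \<noteq> {}" using assms by (auto simp: path_graph_def)
    fix u v assume "u \<in> pverts (path_graph n)" "v \<in> pverts (path_graph n)"
    then have "u < n" "v < n" by (auto simp: path_graph_def)
    then have "u \<rightarrow>\<^sup>*\<^bsub>with_proj (path_graph n)\<^esub> v"
      using reachable_trans[OF symmetric_reachable'[OF reach] reach] by simp
    then show "u \<rightarrow>\<^sup>*\<^bsub>mk_symmetric (with_proj (path_graph n))\<^esub> v"
      by (rule reachable_mk_symmetricI)
  qed
  moreover have "\<not> (length p \<ge> 3 \<and> (last p, hd p) \<in> parcs (path_graph n))"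
    if "vpath p (with_proj (path_graph n))" for p
  proof
    assume "length p \<ge> 3 \<and> (last p, hd p) \<in> parcs (path_graph n)"
    then have "length p \<ge> 3" "hd p = Suc (last p) \<or> last p = Suc (hd p)"
      by (simp_all add: path_graph_def)
    \<comment> \<open>By monotonicity the ends of a path with at least three vertices differ by at
      least 2.\<close>
    with vpath_path_graph_monotone[OF that] show False by linarith
  qed
  moreover have "0 \<in> pverts (path_graph n)"
    using assms by (simp add: path_graph_def)
  ultimately show ?thesis
    using pair_graph_path_graph unfolding rooted_tree_def undirected_tree_def by blast
qed

lemma proper_ancestor_path_graph:
  assumes "i < j" "j < n"
  shows "proper_ancestor (path_graph n) 0 i j"
  unfolding proper_ancestor_def
  using vpath_path_graph_upt[OF assms(2)] assms
  by (intro conjI exI[of _ "[0..<Suc j]"]) (auto simp: hd_upt simp del: upt_Suc)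

lemma treedepth_attained:
  assumes "pair_graph G" "pverts G \<noteq> {}"
  obtains T :: "nat pair_pre_digraph" and r f
  where "rooted_tree T r" "tree_height T r = treedepth G"
    "subgraph_embedding f G (tree_closure T r)"
proof -
  interpret pair_graph G by fact
  define n where "n = card (pverts G)"
  have "n > 0" using assms(2) by (simp add: n_def card_gt_0_iff)
  obtain f where f: "bij_betw f (pverts G) {..<n}"
    using ex_bij_betw_finite_nat[OF pair_finite_verts] by (auto simp: n_def atLeast0LessThan)
  have "subgraph_embedding f G (tree_closure (path_graph n) 0)"
    unfolding subgraph_embedding_def
  proof (intro conjI ballI, goal_cases)
    case (3 e)
    obtain u v where e: "e = (u, v)" by force
    with 3 have "(u, v) \<in> parcs G" by simp
    then have "u \<in> pverts G" "v \<in> pverts G" "u \<noteq> v"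
      using wellformed' no_loops' by auto
    then have "f u < n" "f v < n" "f u \<noteq> f v"
      using f by (auto simp: bij_betw_def inj_on_def)
    then show ?case
      using proper_ancestor_path_graph by (auto simp: e tree_closure_def neq_iff)
  qed (use f in \<open>auto simp: bij_betw_def tree_closure_def path_graph_def\<close>)
  then have "{k. \<exists>(T :: nat pair_pre_digraph) r f.
     rooted_tree T r \<and> tree_height T r = k \<and> subgraph_embedding f G (tree_closure T r)} \<noteq> {}"
    using rooted_tree_path_graph[OF \<open>n > 0\<close>] by blast
  from Inf_nat_def1[OF this] show ?thesis
    using that unfolding treedepth_def[symmetric] by blast
qed

text \<open>Each vertex is labelled with the root path of its image. From here on the tree is
  forgotten and only prefix comparisons remain.\<close>

lemma treedepth_labelling:
  assumes "pair_graph G" "pverts G \<noteq> {}"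
  obtains h :: "'a \<Rightarrow> nat list" where "inj_on h (pverts G)"
    "\<And>v. v \<in> pverts G \<Longrightarrow> h v \<noteq> [] \<and> length (h v) \<le> treedepth G"
    "\<And>u v. (u, v) \<in> parcs G \<Longrightarrow> strict_prefix (h u) (h v) \<or> strict_prefix (h v) (h u)"
proof -
  obtain T :: "nat pair_pre_digraph" and r f where T: "rooted_tree T r"
    and height: "tree_height T r = treedepth G"
    and f: "subgraph_embedding f G (tree_closure T r)"
    using treedepth_attained[OF assms] .
  have f_verts: "f v \<in> pverts T" if "v \<in> pverts G" for v
    using f that by (auto simp: subgraph_embedding_def tree_closure_def)
  show ?thesis
  proof (rule that[of "\<lambda>v. root_path T r (f v)"])
    show "inj_on (\<lambda>v. root_path T r (f v)) (pverts G)"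
    proof (rule inj_onI)
      fix x y assume "x \<in> pverts G" "y \<in> pverts G" "root_path T r (f x) = root_path T r (f y)"
      then show "x = y"
        using root_path_vpath(3)[OF T f_verts] f
        by (metis inj_onD subgraph_embedding_def)
    qed
  next
    fix v assume "v \<in> pverts G"
    then show "root_path T r (f v) \<noteq> [] \<and> length (root_path T r (f v)) \<le> treedepth G"
      using root_path_vpath(1)[OF T f_verts] length_root_path_le[OF T f_verts] height
      by (auto elim!: vpathE vwalkE)
  next
    fix u v assume "(u, v) \<in> parcs G"
    then have "(f u, f v) \<in> parcs (tree_closure T r)"
      using f by (auto simp: subgraph_embedding_def)
    then show "strict_prefix (root_path T r (f u)) (root_path T r (f v)) \<or>
      strict_prefix (root_path T r (f v)) (root_path T r (f u))"
      by (rule tree_closure_arc_root_path[OF T])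
  qed
qed

section \<open>Marking games on labelled graphs\<close>

text \<open>
  The label of a vertex stands for its root path in an elimination tree, so that ancestors are
  proper prefixes.
\<close>

locale prefix_labelled_graph = pair_graph G for G :: "'a pair_pre_digraph" +
  fixes h :: "'a \<Rightarrow> 'b list" and k :: nat and r :: 'a
  assumes inj_label: "inj_on h (pverts G)"
    and label_nonempty: "v \<in> pverts G \<Longrightarrow> h v \<noteq> []"
    and length_label_le: "v \<in> pverts G \<Longrightarrow> length (h v) \<le> k"
    and arc_comparable: "(u, v) \<in> parcs G \<Longrightarrow> strict_prefix (h u) (h v) \<or> strict_prefix (h v) (h u)"
    and root_in_verts: "r \<in> pverts G"
    and root_least: "v \<in> pverts G \<Longrightarrow> prefix (h r) (h v)"
    and connected: "connected (with_proj G)"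
begin

abbreviation anc :: "'a \<Rightarrow> 'a \<Rightarrow> bool" where
  "anc u v \<equiv> strict_prefix (h u) (h v)"

text \<open>The asymmetry with \<open>lower\<close> is deliberate: Alice's replies are ancestors of
  \<open>v\<close> that need not be adjacent to \<open>v\<close>, whereas descendants matter only if
  they add to the score.\<close>

definition upper :: "'a list \<Rightarrow> 'a \<Rightarrow> 'a set" where
  "upper xs v = {u \<in> set xs. anc u v}"

definition lower :: "'a list \<Rightarrow> 'a \<Rightarrow> 'a set" where
  "lower xs v = {u \<in> set xs. anc v u \<and> (u, v) \<in> parcs G}"

text \<open>
  A vertex that is not adjacent to the root has one ancestor that never counts towards its score;
  this pays for the only marked descendant that Alice may inflict on it.
\<close>

definition bonus :: "'a list \<Rightarrow> 'a \<Rightarrow> nat" where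
  "bonus xs v = (if (r, v) \<notin> parcs G \<and> marked_neighbors G xs v \<noteq> {} then 1 else 0)"

lemma finite_upper [simp]: "finite (upper xs v)" and finite_lower [simp]: "finite (lower xs v)"
  by (simp_all add: upper_def lower_def)

lemma anc_root:
  assumes "v \<in> pverts G" "v \<noteq> r"
  shows "anc r v"
  using root_least[OF assms(1)] inj_onD[OF inj_label _ root_in_verts assms(1)] assms(2)
  by (auto simp: strict_prefix_def)

lemma anc_length: "anc u v \<Longrightarrow> length (h u) < length (h v)"
  by (rule prefix_length_less)

text \<open>The labels of ancestors are nonempty proper prefixes of \<open>h v\<close>, hence
  determined by their lengths.\<close>

lemma card_ancestors_le:
  assumes "v \<in> pverts G"
  shows "card {u \<in> pverts G. anc u v} \<le> length (h v) - 1"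
proof -
  let ?A = "{u \<in> pverts G. anc u v}"
  have "inj_on (length \<circ> h) ?A"
  proof (rule inj_onI)
    fix x y assume xy: "x \<in> ?A" "y \<in> ?A" and "(length \<circ> h) x = (length \<circ> h) y"
    then have "h x = h y"
      by (metis (mono_tags, lifting) comp_apply mem_Collect_eq prefix_order.less_imp_le
          prefix_same_cases prefix_order.le_imp_less_or_eq anc_length less_irrefl)
    with xy show "x = y" using inj_label by (auto dest: inj_onD)
  qed
  moreover have "(length \<circ> h) ` ?A \<subseteq> {1..<length (h v)}"
    using anc_length label_nonempty by (auto simp: Suc_le_eq)
  ultimately show ?thesis
    using card_inj_on_le[of "length \<circ> h" ?A "{1..<length (h v)}"] by simp
qed

text \<open>The bonus cancels: it raises the bound on \<open>lower\<close> by one only when the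
  root, an ancestor, is not a neighbour. So the score is at most twice the number of
  ancestors.\<close>

lemma card_marked_neighbors_le:
  assumes "k \<ge> 3" "v \<in> pverts G - set xs" "set xs \<subseteq> pverts G" "r \<in> set xs"
    and le: "card (lower xs v) \<le> card (upper xs v) + bonus xs v"
  shows "card (marked_neighbors G xs v) \<le> 2 * k - 4"
proof -
  let ?A = "{u \<in> pverts G. anc u v}"
  let ?B = "{u \<in> ?A. (u, v) \<in> parcs G}"
  have v: "v \<in> pverts G" "v \<noteq> r" using assms by auto
  have fin: "finite ?A" by (simp add: pair_finite_verts)
  have "marked_neighbors G xs v \<subseteq> ?B \<union> lower xs v"
    using assms(3) arc_comparable by (auto simp: marked_neighbors_def lower_def)
  then have "card (marked_neighbors G xs v) \<le> card (?B \<union> lower xs v)"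
    using fin by (intro card_mono) auto
  also have "\<dots> \<le> card ?B + card (lower xs v)" by (rule card_Un_le)
  finally have score: "card (marked_neighbors G xs v) \<le> card ?B + card (lower xs v)" .
  have upper_le: "card (upper xs v) \<le> card ?A"
    using fin assms(3) by (intro card_mono) (auto simp: upper_def)
  have "card ?B + bonus xs v \<le> card ?A"
  proof (cases "(r, v) \<in> parcs G")
    case True
    have "card ?B \<le> card ?A" using fin by (rule card_mono) auto
    with True show ?thesis by (simp add: bonus_def)
  next
    case False
    then have "?B \<subset> ?A" using anc_root[OF v] root_in_verts by auto
    then have "card ?B < card ?A" by (rule psubset_card_mono[OF fin])
    moreover have "bonus xs v \<le> 1" by (simp add: bonus_def)
    ultimately show ?thesis by linarith
  qed
  with score le upper_le have twice: "card (marked_neighbors G xs v) \<le> 2 * card ?A"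
    by linarith
  have A_le: "card ?A \<le> length (h v) - 1" by (rule card_ancestors_le[OF v(1)])
  show ?thesis
  proof (cases "length (h v) < k")
    case True
    then show ?thesis using twice A_le by linarith
  next
    case False
    have "lower xs v = {}"
      using False anc_length length_label_le assms(3) by (force simp: lower_def)
    moreover have "card ?B \<le> card ?A" using fin by (intro card_mono) auto
    \<comment> \<open>Only ancestors count here, and \<open>k - 1 \<le> 2 * k - 4\<close> because
      \<open>k \<ge> 3\<close>.\<close>
    ultimately show ?thesis
      using score A_le length_label_le[OF v(1)] assms(1) by auto
  qed
qed

lemma bonus_mono: "bonus xs v \<le> bonus (xs @ [x]) v"
  by (auto simp: bonus_def marked_neighbors_def)

lemma upper_snoc: "upper (xs @ [x]) v = (if anc x v then insert x (upper xs v) else upper xs v)"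
  and lower_snoc: "lower (xs @ [x]) v =
    (if anc v x \<and> (x, v) \<in> parcs G then insert x (lower xs v) else lower xs v)"
  by (auto simp: upper_def lower_def)

lemma card_upper_snoc:
  "x \<notin> set xs \<Longrightarrow> card (upper (xs @ [x]) v) = card (upper xs v) + (if anc x v then 1 else 0)"
  by (subst upper_snoc) (auto simp: upper_def)

lemma card_lower_snoc:
  "x \<notin> set xs \<Longrightarrow> card (lower (xs @ [x]) v) =
    card (lower xs v) + (if anc v x \<and> (x, v) \<in> parcs G then 1 else 0)"
  by (subst lower_snoc) (auto simp: lower_def)

end

text \<open>Isolates what the argument uses of the rules, so that one strategy serves both games.
  Adjacent moves are required to be legal only in reachable states, since in the connected game this
  relies on the marked set being connected.\<close>

locale prefix_labelled_game = prefix_labelled_graph +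
  fixes rule :: "'a marking_rule"
  assumes legal_unmarked: "rule xs v \<Longrightarrow> v \<in> pverts G \<and> v \<notin> set xs"
    and legal_first: "v \<in> pverts G \<Longrightarrow> rule [] v"
    and legal_adjacent: "game_state rule \<sigma> xs \<Longrightarrow> w \<in> set xs \<Longrightarrow> (w, v) \<in> parcs G \<Longrightarrow>
      v \<notin> set xs \<Longrightarrow> rule xs v"
begin

section \<open>Alice's strategy and its invariant\<close>

definition candidate :: "'a list \<Rightarrow> 'a \<Rightarrow> bool" where
  "candidate xs w \<longleftrightarrow> rule xs w \<and> ((\<exists>u. rule xs u \<and> anc u (last xs)) \<longrightarrow> anc w (last xs))"

text \<open>The implication in \<open>candidate\<close> lets a single \<open>arg_min\<close> cover
  both modes. When Alice is to move in a nonempty state, \<open>last xs\<close> is Bob's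
  vertex.\<close>

definition strategy :: "'a list \<Rightarrow> 'a" where
  "strategy xs = (if xs = [] then r else arg_min (\<lambda>w. length (h w)) (candidate xs))"

lemma
  assumes "xs \<noteq> []" "rule xs u"
  shows candidate_strategy: "candidate xs (strategy xs)"
    and strategy_minimal: "\<not> anc u (strategy xs)"
    and strategy_answers: "anc u (last xs) \<Longrightarrow> strategy xs = u \<or> anc (strategy xs) u"
proof -
  have "\<exists>w. candidate xs w"
    using assms(2) unfolding candidate_def by blast
  then show cand: "candidate xs (strategy xs)"
    using assms(1) by (auto simp: strategy_def intro: arg_min_natI)
  have le: "length (h (strategy xs)) \<le> length (h w)" if "candidate xs w" for w
    using assms(1) that by (auto simp: strategy_def intro: arg_min_nat_le)
  show "\<not> anc u (strategy xs)"
  proof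
    assume u: "anc u (strategy xs)"
    \<comment> \<open>In either mode a legal ancestor of a candidate is a candidate, by transitivity
      of \<open>anc\<close>.\<close>
    then have "candidate xs u"
      using cand assms(2) prefix_order.less_trans[OF u] by (auto simp: candidate_def)
    then show False using le anc_length[OF u] by fastforce
  qed
  assume u: "anc u (last xs)"
  then have "candidate xs u" "anc (strategy xs) (last xs)"
    using cand assms(2) by (auto simp: candidate_def)
  \<comment> \<open>Both labels are prefixes of \<open>h (last xs)\<close>, hence comparable, and
    the minimal one is not longer.\<close>
  then have "prefix (h (strategy xs)) (h u)"
    using u le[of u] by (meson prefix_length_prefix prefix_order.less_imp_le)
  moreover have "strategy xs \<in> pverts G" "u \<in> pverts G"
    using cand assms(2) legal_unmarked by (auto simp: candidate_def)
  ultimately show "strategy xs = u \<or> anc (strategy xs) u"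
    using inj_label by (auto simp: strict_prefix_def dest: inj_onD)
qed

text \<open>The stronger inequality is a slack of one that absorbs Bob's next move. It holds at
  every unmarked vertex after Alice's moves; Bob can destroy it only where his vertex enters
  \<open>lower\<close>, and there Alice's reply restores it.\<close>

lemma game_state_invariant:
  assumes "game_state rule strategy xs" "xs \<noteq> []"
  shows "r \<in> set xs \<and> set xs \<subseteq> pverts G \<and> (\<forall>v \<in> pverts G - set xs.
    card (lower xs v) \<le> card (upper xs v) + bonus xs v \<and>
    (odd (length xs) \<or> last xs \<notin> lower xs v \<longrightarrow>
      card (lower xs v) + 1 \<le> card (upper xs v) + bonus xs v))"
  using assms
proof (induction xs rule: game_state.induct)
  case start
  then show ?case by simp
next
  case (alice xs)
  define x where "x = strategy xs"
  have x: "x \<in> pverts G" "x \<notin> set xs"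
    using legal_unmarked[OF alice.hyps(3)] by (auto simp: x_def)
  show ?case
  proof (cases "xs = []")
    case True
    have "strategy [] = r" by (simp add: strategy_def)
    \<comment> \<open>The marked root is an ancestor of every other vertex, which supplies the
      initial slack.\<close>
    moreover have "lower [r] v = {}" "upper [r] v = {r}" if "v \<in> pverts G" "v \<noteq> r" for v
      using anc_root[OF that] by (auto simp: lower_def upper_def)
    ultimately show ?thesis
      using root_in_verts by (simp add: True)
  next
    case False
    note IH = alice.IH[OF False]
    have "card (lower (xs @ [x]) v) + 1 \<le> card (upper (xs @ [x]) v) + bonus (xs @ [x]) v"
      if v: "v \<in> pverts G" "v \<notin> set xs" "v \<noteq> x" for v
    proof (cases "last xs \<in> lower xs v")
      case True
      then have "(last xs, v) \<in> parcs G" "anc v (last xs)"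
        by (auto simp: lower_def)
      moreover from this have "rule xs v"
        using legal_adjacent[OF alice.hyps(1) last_in_set[OF False]] v(2) by blast
      \<comment> \<open>Since \<open>v\<close> is a legal ancestor of Bob's vertex and is not
        chosen, the choice lies above it: \<open>upper\<close> grows and \<open>lower\<close> does
        not.\<close>
      ultimately have "anc x v"
        using strategy_answers[OF False] v(3) by (auto simp: x_def)
      moreover from this have "\<not> anc v x" by auto
      moreover have "card (lower xs v) \<le> card (upper xs v) + bonus xs v"
        using IH v by blast
      ultimately show ?thesis
        using x(2) bonus_mono[of xs v x] by (simp add: card_upper_snoc card_lower_snoc)
    next
      case not_last: False
      then have strong: "card (lower xs v) + 1 \<le> card (upper xs v) + bonus xs v"
        using IH v by blast
      show ?thesis
      proof (cases "anc v x \<and> (x, v) \<in> parcs G")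
        case True
        then have "\<not> rule xs v"
          using strategy_minimal[OF False] by (auto simp: x_def)
        then have "marked_neighbors G xs v = {}"
          using legal_adjacent[OF alice.hyps(1)] v(2) by (auto simp: marked_neighbors_def)
        \<comment> \<open>As \<open>r\<close> is marked, it is not adjacent to \<open>v\<close>. The
          first marked neighbour \<open>x\<close> thus raises the bonus, which pays for the growth
          of \<open>lower\<close>.\<close>
        then have "bonus xs v = 0" "bonus (xs @ [x]) v = 1"
          using True IH by (auto simp: bonus_def marked_neighbors_def)
        then show ?thesis
          using strong x(2) by (simp add: card_upper_snoc card_lower_snoc)
      next
        case False
        then have "card (lower (xs @ [x]) v) = card (lower xs v)"
          using x(2) by (simp add: card_lower_snoc)
        moreover have "card (upper xs v) \<le> card (upper (xs @ [x]) v)"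
          using x(2) by (simp add: card_upper_snoc)
        ultimately show ?thesis
          using strong bonus_mono[of xs v x] by linarith
      qed
    qed
    then show ?thesis
      using IH x by (auto simp: x_def[symmetric] intro: Suc_leD)
  qed
next
  case (bob xs x)
  have x: "x \<in> pverts G" "x \<notin> set xs"
    using legal_unmarked[OF bob.hyps(3)] by auto
  have "xs \<noteq> []" using bob.hyps(2) by auto
  note IH = bob.IH[OF this]
  have "card (lower (xs @ [x]) v) \<le> card (upper (xs @ [x]) v) + bonus (xs @ [x]) v \<and>
      (x \<notin> lower (xs @ [x]) v \<longrightarrow>
        card (lower (xs @ [x]) v) + 1 \<le> card (upper (xs @ [x]) v) + bonus (xs @ [x]) v)"
    if v: "v \<in> pverts G" "v \<notin> set xs" "v \<noteq> x" for v
  proof -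
    \<comment> \<open>The slack left by Alice's move; Bob's move adds at most one vertex to
      \<open>lower\<close>.\<close>
    have "card (lower xs v) + 1 \<le> card (upper xs v) + bonus xs v"
      using IH v bob.hyps(2) by blast
    moreover have "card (upper xs v) \<le> card (upper (xs @ [x]) v)"
      using x(2) by (simp add: card_upper_snoc)
    moreover have "card (lower (xs @ [x]) v) =
        card (lower xs v) + (if x \<in> lower (xs @ [x]) v then 1 else 0)"
      using x(2) by (simp add: card_lower_snoc) (simp add: lower_def)
    ultimately show ?thesis
      using bonus_mono[of xs v x] by (auto split: if_splits)
  qed
  then show ?case
    using IH x bob.hyps(2) by auto
qed

text \<open>It suffices that some legal move exists. Otherwise the marked set would contain
  \<open>r\<close> and be closed under adjacency, hence be everything by connectedness.\<close>

lemma legal_strategy: "legal_strategy G rule strategy"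
  unfolding legal_strategy_def
proof (intro allI impI, elim conjE)
  fix xs assume state: "game_state rule strategy xs" and "set xs \<noteq> pverts G"
  show "rule xs (strategy xs)"
  proof (cases "xs = []")
    case True
    then show ?thesis using legal_first[OF root_in_verts] by (simp add: strategy_def)
  next
    case False
    note inv = game_state_invariant[OF state False]
    have "\<exists>w v. w \<in> set xs \<and> (w, v) \<in> parcs G \<and> v \<notin> set xs"
    proof (rule ccontr)
      assume closed: "\<not> ?thesis"
      have "v \<in> set xs" if "v \<in> pverts G" for v
        by (rule connected_vertex_induct[OF pair_graph connected root_in_verts that])
          (use inv closed in auto)
      with inv \<open>set xs \<noteq> pverts G\<close> show False by blast
    qed
    then obtain v where "rule xs v" using legal_adjacent[OF state] by blast
    then show ?thesis using candidate_strategy[OF False] by (simp add: candidate_def)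
  qed
qed

lemma alice_guarantees:
  assumes "k \<ge> 3"
  shows "alice_guarantees G rule (2 * k - 3)"
  unfolding alice_guarantees_def
proof (intro exI[of _ strategy] conjI legal_strategy allI impI ballI)
  fix xs v assume state: "game_state rule strategy xs" and v: "v \<in> pverts G - set xs"
  show "card (marked_neighbors G xs v) + 1 \<le> 2 * k - 3"
  proof (cases "xs = []")
    case True
    then show ?thesis using assms by (simp add: marked_neighbors_def)
  next
    case False
    then have "card (marked_neighbors G xs v) \<le> 2 * k - 4"
      using game_state_invariant[OF state False] assms v
      by (intro card_marked_neighbors_le) auto
    then show ?thesis using assms by linarith
  qed
qed

end

section \<open>Both marking games as instances\<close>

context prefix_labelled_graph
begin

lemma prefix_labelled_game_marking_move: "prefix_labelled_game G h k r (marking_move G)"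
  by unfold_locales (auto simp: marking_move_def dest: wellformed')

text \<open>The last move alone certifies this. The initial state is excluded because the empty
  graph does not count as connected.\<close>

lemma connected_game_state:
  assumes "game_state (connected_marking_move G) \<sigma> xs" "xs \<noteq> []"
  shows "connected (with_proj G \<restriction> set xs)"
  using assms by cases (auto simp: connected_marking_move_def)

lemma prefix_labelled_game_connected_marking_move:
  "prefix_labelled_game G h k r (connected_marking_move G)"
proof unfold_locales
  fix \<sigma> xs w v
  assume "game_state (connected_marking_move G) \<sigma> xs" "w \<in> set xs" "(w, v) \<in> parcs G" "v \<notin> set xs"
  moreover from this have "connected (with_proj G \<restriction> insert v (set xs))"
    by (intro connected_induce_insert connected_game_state) auto
  ultimately show "connected_marking_move G xs v"
    by (auto simp: connected_marking_move_def marking_move_def dest: wellformed')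
qed (auto simp: connected_marking_move_def marking_move_def connected_induce_singleton)

end

theorem theorem2p1:
  fixes k :: nat and G :: "'a pair_pre_digraph"
  assumes "k \<ge> 3"
    and "pair_graph G"
    and "connected (with_proj G)"
    and "treedepth G = k"
  shows "game_coloring_number G \<le> 2 * k - 3 \<and> connected_game_coloring_number G \<le> 2 * k - 3"
proof -
  interpret pair_graph G by fact
  have "pverts G \<noteq> {}" using assms(3) by (simp add: connected_conv)
  then obtain h :: "'a \<Rightarrow> nat list" where h: "inj_on h (pverts G)"
    "\<And>v. v \<in> pverts G \<Longrightarrow> h v \<noteq> [] \<and> length (h v) \<le> treedepth G"
    "\<And>u v. (u, v) \<in> parcs G \<Longrightarrow> strict_prefix (h u) (h v) \<or> strict_prefix (h v) (h u)"
    using treedepth_labelling[OF assms(2)] by blast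
  \<comment> \<open>The root of the tree need not be the image of a vertex, so a vertex with a
    shortest label takes its place.\<close>
  obtain r where r: "r \<in> pverts G"
    and shortest: "\<And>v. v \<in> pverts G \<Longrightarrow> length (h r) \<le> length (h v)"
    using ex_has_least_nat[of "\<lambda>v. v \<in> pverts G" _ "\<lambda>v. length (h v)"] \<open>pverts G \<noteq> {}\<close> by blast
  have "prefix (h r) (h v)" if "v \<in> pverts G" for v
  proof (rule connected_vertex_induct[OF assms(2,3) r that])
    fix u w assume u: "prefix (h r) (h u)" and "(u, w) \<in> parcs G"
    then consider "prefix (h u) (h w)" | "prefix (h w) (h u)" "w \<in> pverts G"
      using h(3) wellformed' by (auto simp: strict_prefix_def)
    \<comment> \<open>In the second case \<open>h r\<close> and \<open>h w\<close> are both prefixes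
      of \<open>h u\<close>, and \<open>h r\<close> is not longer.\<close>
    then show "prefix (h r) (h w)"
      using u shortest by cases (auto intro: prefix_length_prefix prefix_order.trans)
  qed simp
  then interpret prefix_labelled_graph G h k r
    using h r assms(3,4) by unfold_locales auto
  interpret marking: prefix_labelled_game G h k r "marking_move G"
    by (rule prefix_labelled_game_marking_move)
  interpret connected_marking: prefix_labelled_game G h k r "connected_marking_move G"
    by (rule prefix_labelled_game_connected_marking_move)
  show ?thesis
    unfolding game_coloring_number_def connected_game_coloring_number_def
    using marking.alice_guarantees connected_marking.alice_guarantees assms(1)
    by (auto intro: Least_le)
qed

end
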